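(* Let $(X,\trianglelefteq)$ be a parallel ordered locale satisfying (C-$\vee$) with regular cones. Then there are bijections $$\mathrm{pt}'(X^{\triangle})\cong\mathrm{IP}(X)\qquad\text{and}\qquad\mathrm{pt}'(X^{\triangledown})\cong\mathrm{IF}(X).$$
   Context: A locale $X$ is given by a frame $\mathcal{O}X$ (order $\sqsubseteq$, bottom $\varnothing$, top $X$). An ordered locale $(X,\trianglelefteq)$ is a locale with a preorder $\trianglelefteq$ on $\mathcal{O}X$ such that $U_i\trianglelefteq V_i$ for all $i\in I$ implies $\bigvee_iU_i\trianglelefteq\bigvee_iV_i$ (any index set). Localic cones: $\Uparrow U=\bigvee\{V:U\trianglelefteq V\}$, $\Downarrow U=\bigvee\{W:W\trianglelefteq U\}$. (C-$\vee$): $\Uparrow$ and $\Downarrow$ preserve arbitrary joins. Parallel ordered: (i) if $U\sqsubseteq V\trianglelefteq V'$ there is $U'$ with $U\trianglelefteq U'\sqsubseteq V'$; (ii) if $V\trianglelefteq V'$ and $U'\sqsubseteq V'$ there is $U\sqsubseteq V$ with $U\trianglelefteq U'$; (iii) $U\trianglelefteq\varnothing$ or $\varnothing\trianglelefteq U$ implies $U=\varnothing$. Regular cones: $\neg\neg\Uparrow U=\Uparrow U=\Uparrow\neg\neg U$ and $\neg\neg\Downarrow U=\Downarrow U=\Downarrow\neg\neg U$ for all $U\in\mathcal{O}X$, where $\neg$ is Heyting negation in $\mathcal{O}X$. Under (C-$\vee$), $\operatorname{im}(\Uparrow)=\{\Uparrow U\}$ and $\operatorname{im}(\Downarrow)=\{\Downarrow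 U\}$ are subframes of $\mathcal{O}X$; $X^{\triangle}$ (locale of futures) is the locale with frame $\operatorname{im}(\Uparrow)$ and $X^{\triangledown}$ (locale of pasts) that with frame $\operatorname{im}(\Downarrow)$. For a locale $Y$, $\mathrm{pt}'(Y)$ is the set of prime elements of $\mathcal{O}Y$: those $P\neq$ top such that $U\wedge V\sqsubseteq P$ implies $U\sqsubseteq P$ or $V\sqsubseteq P$. $\mathrm{IP}(X)$ is the set of $P\in\mathcal{O}X$ with $\varnothing\neq P=\Downarrow P$ such that $P=\Downarrow U\vee\Downarrow V$ implies $P=\Downarrow U$ or $P=\Downarrow V$. $\mathrm{IF}(X)$ is the set of $F\in\mathcal{O}X$ with $\varnothing\neq F=\Uparrow F$ such that $F=\Uparrow U\vee\Uparrow V$ implies $F=\Uparrow U$ or $F=\Uparrow V$. *)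

theory Defs
  imports Main
begin

unbundle lattice_syntax

(* The library class complete_distrib_lattice demands complete distributivity and is strictly
   stronger than the frame law. *)
class frame = complete_lattice +
  assumes inf_Sup_distrib: "a \<sqinter> \<Squnion>B = (\<Squnion>b\<in>B. a \<sqinter> b)"

definition heyting_imp :: "'a::frame \<Rightarrow> 'a \<Rightarrow> 'a" where
  "heyting_imp U W = \<Squnion>{V. V \<sqinter> U \<le> W}"

lemma le_heyting_imp_iff: "V \<le> heyting_imp U W \<longleftrightarrow> V \<sqinter> U \<le> W"
proof
  assume "V \<le> heyting_imp U W"
  then have "V \<sqinter> U \<le> U \<sqinter> \<Squnion>{V. V \<sqinter> U \<le> W}"
    by (simp add: heyting_imp_def le_infI1)
  also have "\<dots> \<le> W"
    by (auto simp: inf_Sup_distrib inf_commute intro!: SUP_least)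
  finally show "V \<sqinter> U \<le> W" .
qed (auto simp: heyting_imp_def intro: Sup_upper)

definition heyting_neg :: "'a::frame \<Rightarrow> 'a" where
  "heyting_neg U = heyting_imp U \<bottom>"

definition subframe :: "'a::frame set \<Rightarrow> bool" where
  "subframe S \<longleftrightarrow> \<top> \<in> S \<and> (\<forall>U\<in>S. \<forall>V\<in>S. U \<sqinter> V \<in> S) \<and> (\<forall>A. A \<subseteq> S \<longrightarrow> \<Squnion>A \<in> S)"

(* A locale Y is presented here by a subframe S of an ambient frame (S = UNIV being the ambient
   frame itself), so that top, binary meets and order of S are the ambient ones. *)
definition prime_elements :: "'a::frame set \<Rightarrow> 'a set" where
  "prime_elements S =
     {P \<in> S. P \<noteq> \<top> \<and> (\<forall>U\<in>S. \<forall>V\<in>S. U \<sqinter> V \<le> P \<longrightarrow> U \<le> P \<or> V \<le> P)}"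

(* Since no definition can quantify over all index types, families (U_i, V_i) of related opens
   are represented by the sets R of their pairs; see indexed_Sup_rel below. *)
locale ordered_locale =
  fixes rel :: "'a::frame \<Rightarrow> 'a \<Rightarrow> bool" (infix "\<unlhd>" 50)
  assumes rel_refl: "U \<unlhd> U"
    and rel_trans: "U \<unlhd> V \<Longrightarrow> V \<unlhd> W \<Longrightarrow> U \<unlhd> W"
    and Sup_rel: "(\<And>U V. (U, V) \<in> R \<Longrightarrow> U \<unlhd> V) \<Longrightarrow> \<Squnion>(fst ` R) \<unlhd> \<Squnion>(snd ` R)"
begin

lemma indexed_Sup_rel:
  assumes "\<And>i. i \<in> I \<Longrightarrow> U i \<unlhd> V i"
  shows "(\<Squnion>i\<in>I. U i) \<unlhd> (\<Squnion>i\<in>I. V i)"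
  using Sup_rel[of "(\<lambda>i. (U i, V i)) ` I"] assms by (auto simp: image_image)

end

definition up_cone :: "('a::frame \<Rightarrow> 'a \<Rightarrow> bool) \<Rightarrow> 'a \<Rightarrow> 'a" where
  "up_cone rel U = \<Squnion>{V. rel U V}"

definition down_cone :: "('a::frame \<Rightarrow> 'a \<Rightarrow> bool) \<Rightarrow> 'a \<Rightarrow> 'a" where
  "down_cone rel U = \<Squnion>{W. rel W U}"

locale parallel_ordered_locale = ordered_locale +
  assumes parallel_up: "U \<le> V \<Longrightarrow> V \<unlhd> V' \<Longrightarrow> \<exists>U'. U \<unlhd> U' \<and> U' \<le> V'"
    and parallel_down: "V \<unlhd> V' \<Longrightarrow> U' \<le> V' \<Longrightarrow> \<exists>U. U \<le> V \<and> U \<unlhd> U'"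
    and rel_bot: "U \<unlhd> \<bottom> \<or> \<bottom> \<unlhd> U \<Longrightarrow> U = \<bottom>"

definition cones_preserve_Sup :: "('a::frame \<Rightarrow> 'a \<Rightarrow> bool) \<Rightarrow> bool" where
  "cones_preserve_Sup rel \<longleftrightarrow>
     (\<forall>A. up_cone rel (\<Squnion>A) = (\<Squnion>U\<in>A. up_cone rel U)) \<and>
     (\<forall>A. down_cone rel (\<Squnion>A) = (\<Squnion>U\<in>A. down_cone rel U))"

definition regular_cones :: "('a::frame \<Rightarrow> 'a \<Rightarrow> bool) \<Rightarrow> bool" where
  "regular_cones rel \<longleftrightarrow>
     (\<forall>U. heyting_neg (heyting_neg (up_cone rel U)) = up_cone rel U \<and>
          up_cone rel U = up_cone rel (heyting_neg (heyting_neg U)) \<and>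
          heyting_neg (heyting_neg (down_cone rel U)) = down_cone rel U \<and>
          down_cone rel U = down_cone rel (heyting_neg (heyting_neg U)))"

definition futures :: "('a::frame \<Rightarrow> 'a \<Rightarrow> bool) \<Rightarrow> 'a set" where
  "futures rel = range (up_cone rel)"

definition pasts :: "('a::frame \<Rightarrow> 'a \<Rightarrow> bool) \<Rightarrow> 'a set" where
  "pasts rel = range (down_cone rel)"

lemma subframe_range:
  fixes c :: "'a::frame \<Rightarrow> 'a"
  assumes Sup: "\<And>A. c (\<Squnion>A) = (\<Squnion>U\<in>A. c U)"
    and infl: "\<And>U. U \<le> c U" and idem: "\<And>U. c (c U) = c U"
  shows "subframe (range c)"
proof -
  have "c U \<squnion> c V = c (U \<squnion> V)" for U V
    using Sup[of "{U, V}"] by simp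
  then have mono: "c U \<le> c V" if "U \<le> V" for U V
    using that by (metis sup.absorb_iff2)
  have fixed: "range c = {U. c U = U}"
    using idem by (auto simp: image_iff) metis
  have "c (U \<sqinter> V) = U \<sqinter> V" if "c U = U" "c V = V" for U V
    using mono[of "U \<sqinter> V" U] mono[of "U \<sqinter> V" V] that by (intro antisym infl) simp
  moreover have "c (\<Squnion>A) = \<Squnion>A" if "A \<subseteq> {U. c U = U}" for A
  proof -
    have "c ` A = A" using that by force
    then show ?thesis by (simp add: Sup)
  qed
  ultimately show ?thesis
    using infl[of \<top>] by (simp add: fixed subframe_def top_unique)
qed

context ordered_locale
begin

lemma rel_up_cone: "U \<unlhd> up_cone (\<unlhd>) U"
proof -
  have "(\<Squnion>V\<in>{V. U \<unlhd> V}. U) = U"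
    using rel_refl by (intro cSUP_const) auto
  then show ?thesis
    using indexed_Sup_rel[of "{V. U \<unlhd> V}" "\<lambda>_. U" "\<lambda>V. V"] by (simp add: up_cone_def)
qed

lemma down_cone_rel: "down_cone (\<unlhd>) U \<unlhd> U"
proof -
  have "(\<Squnion>V\<in>{V. V \<unlhd> U}. U) = U"
    using rel_refl by (intro cSUP_const) auto
  then show ?thesis
    using indexed_Sup_rel[of "{V. V \<unlhd> U}" "\<lambda>V. V" "\<lambda>_. U"] by (simp add: down_cone_def)
qed

lemma subframe_futures: "cones_preserve_Sup (\<unlhd>) \<Longrightarrow> subframe (futures (\<unlhd>))"
  unfolding futures_def
proof (rule subframe_range)
  have infl: "U \<le> up_cone (\<unlhd>) U" for U
    by (auto simp: up_cone_def intro: Sup_upper rel_refl)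
  show "U \<le> up_cone (\<unlhd>) U" for U by (rule infl)
  have "U \<unlhd> up_cone (\<unlhd>) (up_cone (\<unlhd>) U)" for U
    using rel_trans rel_up_cone by blast
  then have "up_cone (\<unlhd>) (up_cone (\<unlhd>) U) \<le> up_cone (\<unlhd>) U" for U
    unfolding up_cone_def[of _ U] by (intro Sup_upper) (simp add: up_cone_def)
  then show "up_cone (\<unlhd>) (up_cone (\<unlhd>) U) = up_cone (\<unlhd>) U" for U
    by (intro antisym infl)
qed (simp add: cones_preserve_Sup_def)

lemma subframe_pasts: "cones_preserve_Sup (\<unlhd>) \<Longrightarrow> subframe (pasts (\<unlhd>))"
  unfolding pasts_def
proof (rule subframe_range)
  have infl: "U \<le> down_cone (\<unlhd>) U" for U
    by (auto simp: down_cone_def intro: Sup_upper rel_refl)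
  show "U \<le> down_cone (\<unlhd>) U" for U by (rule infl)
  have "down_cone (\<unlhd>) (down_cone (\<unlhd>) U) \<unlhd> U" for U
    using rel_trans down_cone_rel by blast
  then have "down_cone (\<unlhd>) (down_cone (\<unlhd>) U) \<le> down_cone (\<unlhd>) U" for U
    unfolding down_cone_def[of _ U] by (intro Sup_upper) (simp add: down_cone_def)
  then show "down_cone (\<unlhd>) (down_cone (\<unlhd>) U) = down_cone (\<unlhd>) U" for U
    by (intro antisym infl)
qed (simp add: cones_preserve_Sup_def)

end

definition IP :: "('a::frame \<Rightarrow> 'a \<Rightarrow> bool) \<Rightarrow> 'a set" where
  "IP rel = {P. P \<noteq> \<bottom> \<and> P = down_cone rel P \<and>
     (\<forall>U V. P = down_cone rel U \<squnion> down_cone rel V \<longrightarrow>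
        P = down_cone rel U \<or> P = down_cone rel V)}"

definition IF :: "('a::frame \<Rightarrow> 'a \<Rightarrow> bool) \<Rightarrow> 'a set" where
  "IF rel = {F. F \<noteq> \<bottom> \<and> F = up_cone rel F \<and>
     (\<forall>U V. F = up_cone rel U \<squnion> up_cone rel V \<longrightarrow>
        F = up_cone rel U \<or> F = up_cone rel V)}"

end

(* Heyting negation turns futures into pasts and vice versa: if W \<le> U lies in a future F and U
   precedes an open below \<not>F, parallelism pushes W forward into F \<sqinter> \<not>F, so W is empty.
   Regularity makes negation involutive on cones, hence an antitone bijection between the two
   subframes. It carries meet-prime elements to join-prime ones, and these coincide with the
   join-irreducible ones by distributivity. *)
theory Submission
  imports Defs
begin

lemma frame_inf_sup_distrib: "(a::'a::frame) \<sqinter> (b \<squnion> c) = (a \<sqinter> b) \<squnion> (a \<sqinter> c)"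
  using inf_Sup_distrib[of a "{b, c}"] by simp

text \<open>Residuation for \<open>heyting_imp\<close> with target \<bottom>; it turns inequalities
  into \<open>heyting_neg\<close> into disjointness.\<close>

lemma le_heyting_neg_iff: "V \<le> heyting_neg U \<longleftrightarrow> V \<sqinter> U = \<bottom>"
  by (simp add: heyting_neg_def le_heyting_imp_iff bot_unique)

lemma heyting_neg_inf: "heyting_neg U \<sqinter> U = \<bottom>"
  by (simp flip: le_heyting_neg_iff)

lemma heyting_neg_antimono:
  assumes "U \<le> V" shows "heyting_neg V \<le> heyting_neg U"
proof -
  have "heyting_neg V \<sqinter> U \<le> heyting_neg V \<sqinter> V"
    using assms by (rule inf_mono[OF order_refl])
  then show ?thesis
    by (simp add: le_heyting_neg_iff heyting_neg_inf bot_unique)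
qed

lemma subframe_bot: "subframe S \<Longrightarrow> \<bottom> \<in> S"
  unfolding subframe_def by (metis Sup_empty empty_subsetI)

lemma subframe_sup: "subframe S \<Longrightarrow> U \<in> S \<Longrightarrow> V \<in> S \<Longrightarrow> U \<squnion> V \<in> S"
  unfolding subframe_def by (elim conjE allE[of _ "{U, V}"]) simp

text \<open>A common abstraction of \<open>IP\<close> and \<open>IF\<close>: irreducibility is
  tested inside \<open>T\<close>, so one argument can serve both subframes.\<close>

definition sup_irreducibles :: "'a::frame set \<Rightarrow> 'a set" where
  "sup_irreducibles T =
     {P \<in> T. P \<noteq> \<bottom> \<and> (\<forall>U\<in>T. \<forall>V\<in>T. P = U \<squnion> V \<longrightarrow> P = U \<or> P = V)}"

text \<open>Distributivity splits \<open>P\<close> into its meets with \<open>U\<close> and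
  \<open>V\<close>. Both pieces stay in \<open>T\<close>, so irreducibility makes one of them all of
  \<open>P\<close>.\<close>

lemma sup_irreducible_le_sup:
  assumes "subframe T" "P \<in> sup_irreducibles T" "U \<in> T" "V \<in> T" "P \<le> U \<squnion> V"
  shows "P \<le> U \<or> P \<le> V"
proof -
  have "P = (P \<sqinter> U) \<squnion> (P \<sqinter> V)"
    using assms(5) by (simp add: inf_absorb1 flip: frame_inf_sup_distrib)
  moreover have "P \<sqinter> U \<in> T" "P \<sqinter> V \<in> T"
    using assms(1-4) by (auto simp: subframe_def sup_irreducibles_def)
  ultimately have "P = P \<sqinter> U \<or> P = P \<sqinter> V"
    using assms(2) unfolding sup_irreducibles_def by blast
  then show ?thesis
    by (metis inf.cobounded2)
qed

text \<open>An order-reversing involution trades meets in \<open>S\<close> for joins in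
  \<open>T\<close>, hence primality for join-primality. Stated for abstract \<open>S\<close> and
  \<open>T\<close> so that their roles can be swapped.\<close>

lemma bij_betw_prime_elements_sup_irreducibles:
  fixes n :: "'a::frame \<Rightarrow> 'a"
  assumes S: "subframe S" and T: "subframe T"
    and nS: "n ` S \<subseteq> T" and nT: "n ` T \<subseteq> S"
    and invS: "\<And>U. U \<in> S \<Longrightarrow> n (n U) = U" and invT: "\<And>U. U \<in> T \<Longrightarrow> n (n U) = U"
    and anti: "antimono n"
  shows "bij_betw n (prime_elements S) (sup_irreducibles T)"
proof (rule bij_betw_byWitness[where f' = n])
  have inS: "n U \<in> S" if "U \<in> T" for U using nT that by blast
  have inT: "n U \<in> T" if "U \<in> S" for U using nS that by blast
  have topS: "\<top> \<in> S" and infS: "\<And>U V. U \<in> S \<Longrightarrow> V \<in> S \<Longrightarrow> U \<sqinter> V \<in> S"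
    using S by (auto simp: subframe_def)
  \<comment> \<open>Applying \<open>n\<close> to \<open>\<bottom> \<le> n \<top>\<close> gives
    \<open>\<top> \<le> n \<bottom>\<close>. This exchanges the two properness conditions,
    \<open>P \<noteq> \<top>\<close> and \<open>Q \<noteq> \<bottom>\<close>.\<close>
  have n_bot: "n \<bottom> = \<top>"
    using antimonoD[OF anti, of \<bottom> "n \<top>"] invS[OF topS] by (simp add: top_unique)
  show "\<forall>U\<in>prime_elements S. n (n U) = U" "\<forall>U\<in>sup_irreducibles T. n (n U) = U"
    using invS invT by (auto simp: prime_elements_def sup_irreducibles_def)
  show "n ` prime_elements S \<subseteq> sup_irreducibles T"
  proof (rule image_subsetI)
    fix P assume P: "P \<in> prime_elements S"
    then have PS: "P \<in> S" and "P \<noteq> \<top>" by (auto simp: prime_elements_def)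
    then have "n P \<noteq> \<bottom>" using n_bot invS by metis
    moreover have "n P = U \<or> n P = V" if UV: "U \<in> T" "V \<in> T" "n P = U \<squnion> V" for U V
    proof -
      \<comment> \<open>The meet \<open>n U \<sqinter> n V\<close> lies in \<open>S\<close>, so
        applying \<open>n\<close> to the resulting bound on \<open>n P\<close> cancels the double
        \<open>n\<close> and lets primality of \<open>P\<close> act.\<close>
      have "U \<le> n (n U \<sqinter> n V)" "V \<le> n (n U \<sqinter> n V)"
        using antimonoD[OF anti, of "n U \<sqinter> n V"] invT UV by (metis inf_le1, metis inf_le2)
      then have "n P \<le> n (n U \<sqinter> n V)" using UV by simp
      then have "n U \<sqinter> n V \<le> P"
        using antimonoD[OF anti] invS PS infS inS UV by metis
      then have "n U \<le> P \<or> n V \<le> P"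
        using P inS UV unfolding prime_elements_def by blast
      then have "n P \<le> U \<or> n P \<le> V"
        using antimonoD[OF anti] invT UV by metis
      \<comment> \<open>Since \<open>n P\<close> is the join of \<open>U\<close> and
        \<open>V\<close>, it already lies above both; either inequality becomes an equality.\<close>
      then show ?thesis
        using UV(3) by (metis antisym sup_ge1 sup_ge2)
    qed
    ultimately show "n P \<in> sup_irreducibles T"
      using inT PS by (auto simp: sup_irreducibles_def)
  qed
  show "n ` sup_irreducibles T \<subseteq> prime_elements S"
  proof (rule image_subsetI)
    fix Q assume Q: "Q \<in> sup_irreducibles T"
    then have QT: "Q \<in> T" and "Q \<noteq> \<bottom>" by (auto simp: sup_irreducibles_def)
    then have "n Q \<noteq> \<top>" using n_bot invT subframe_bot[OF T] by metis
    moreover have "U \<le> n Q \<or> V \<le> n Q" if UV: "U \<in> S" "V \<in> S" "U \<sqinter> V \<le> n Q" for U V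
    proof -
      \<comment> \<open>Membership in \<open>T\<close> is what allows the double \<open>n\<close> on
        this join to be cancelled below.\<close>
      have join: "n U \<squnion> n V \<in> T" using UV inT subframe_sup[OF T] by blast
      have "n (n U \<squnion> n V) \<le> U" "n (n U \<squnion> n V) \<le> V"
        using antimonoD[OF anti, of _ "n U \<squnion> n V"] invS UV by (metis sup_ge1, metis sup_ge2)
      then have "n (n U \<squnion> n V) \<le> n Q"
        using UV(3) by (meson le_inf_iff order_trans)
      then have "Q \<le> n U \<squnion> n V"
        using antimonoD[OF anti] invT QT join by metis
      then have "Q \<le> n U \<or> Q \<le> n V"
        using sup_irreducible_le_sup[OF T Q] inT UV by blast
      then show ?thesis
        using antimonoD[OF anti] invS UV by metis
    qed
    ultimately show "n Q \<in> prime_elements S"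
      using inS QT by (auto simp: prime_elements_def)
  qed
qed

context ordered_locale
begin

lemma le_up_cone: "U \<unlhd> V \<Longrightarrow> V \<le> up_cone (\<unlhd>) U"
  by (simp add: up_cone_def Sup_upper)

lemma le_down_cone: "V \<unlhd> U \<Longrightarrow> V \<le> down_cone (\<unlhd>) U"
  by (simp add: down_cone_def Sup_upper)

lemma up_cone_idem: "up_cone (\<unlhd>) (up_cone (\<unlhd>) U) = up_cone (\<unlhd>) U"
  by (meson antisym le_up_cone rel_refl rel_trans rel_up_cone)

lemma down_cone_idem: "down_cone (\<unlhd>) (down_cone (\<unlhd>) U) = down_cone (\<unlhd>) U"
  by (meson antisym le_down_cone rel_refl rel_trans down_cone_rel)

lemma futures_iff: "U \<in> futures (\<unlhd>) \<longleftrightarrow> up_cone (\<unlhd>) U = U"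
  unfolding futures_def by (metis rangeE rangeI up_cone_idem)

lemma pasts_iff: "U \<in> pasts (\<unlhd>) \<longleftrightarrow> down_cone (\<unlhd>) U = U"
  unfolding pasts_def by (metis rangeE rangeI down_cone_idem)

text \<open>By idempotence the range of \<open>down_cone\<close> is its set of fixed points, and
  quantifying over that range is quantifying over all cones.\<close>

lemma IP_eq_sup_irreducibles: "IP (\<unlhd>) = sup_irreducibles (pasts (\<unlhd>))"
proof -
  have "P \<in> pasts (\<unlhd>) \<longleftrightarrow> P = down_cone (\<unlhd>) P" for P
    by (auto simp: pasts_iff)
  moreover have "(\<forall>U\<in>pasts (\<unlhd>). Q U) \<longleftrightarrow> (\<forall>U. Q (down_cone (\<unlhd>) U))" for Q
    by (simp add: pasts_def)
  ultimately show ?thesis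
    unfolding IP_def sup_irreducibles_def by (simp only: conj_left_commute)
qed

lemma IF_eq_sup_irreducibles: "IF (\<unlhd>) = sup_irreducibles (futures (\<unlhd>))"
proof -
  have "P \<in> futures (\<unlhd>) \<longleftrightarrow> P = up_cone (\<unlhd>) P" for P
    by (auto simp: futures_iff)
  moreover have "(\<forall>U\<in>futures (\<unlhd>). Q U) \<longleftrightarrow> (\<forall>U. Q (up_cone (\<unlhd>) U))" for Q
    by (simp add: futures_def)
  ultimately show ?thesis
    unfolding IF_def sup_irreducibles_def by (simp only: conj_left_commute)
qed

lemma up_cone_mono:
  assumes "cones_preserve_Sup (\<unlhd>)" "U \<le> V"
  shows "up_cone (\<unlhd>) U \<le> up_cone (\<unlhd>) V"
proof -
  \<comment> \<open>For \<open>U \<le> V\<close> the join of the pair is \<open>V\<close>, so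
    preserving this join places the cone of \<open>U\<close> below that of \<open>V\<close>.\<close>
  have "up_cone (\<unlhd>) (\<Squnion>{U, V}) = (\<Squnion>W\<in>{U, V}. up_cone (\<unlhd>) W)"
    using assms(1) unfolding cones_preserve_Sup_def by blast
  then show ?thesis
    using assms(2) by (simp add: sup_absorb2 le_iff_sup)
qed

lemma down_cone_mono:
  assumes "cones_preserve_Sup (\<unlhd>)" "U \<le> V"
  shows "down_cone (\<unlhd>) U \<le> down_cone (\<unlhd>) V"
proof -
  have "down_cone (\<unlhd>) (\<Squnion>{U, V}) = (\<Squnion>W\<in>{U, V}. down_cone (\<unlhd>) W)"
    using assms(1) unfolding cones_preserve_Sup_def by blast
  then show ?thesis
    using assms(2) by (simp add: sup_absorb2 le_iff_sup)
qed

end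

context parallel_ordered_locale
begin

lemma heyting_neg_future:
  assumes "cones_preserve_Sup (\<unlhd>)" "F \<in> futures (\<unlhd>)"
  shows "heyting_neg F \<in> pasts (\<unlhd>)"
proof -
  let ?D = "down_cone (\<unlhd>) (heyting_neg F)"
  \<comment> \<open>The part of \<open>?D\<close> inside \<open>F\<close> should be empty. As
    \<open>?D\<close> precedes \<open>heyting_neg F\<close>, this part can be pushed forward to some
    \<open>W\<close> there.\<close>
  obtain W where W: "?D \<sqinter> F \<unlhd> W" "W \<le> heyting_neg F"
    using parallel_up[OF inf_le1 down_cone_rel] by blast
  have "W \<le> up_cone (\<unlhd>) (?D \<sqinter> F)" using W(1) by (rule le_up_cone)
  also have "\<dots> \<le> F"
    using up_cone_mono[OF assms(1) inf_le2] assms(2) by (metis futures_iff)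
  finally have "W = \<bottom>"
    using W(2) by (metis heyting_neg_inf le_inf_iff bot_unique)
  \<comment> \<open>Now \<open>?D \<sqinter> F\<close> precedes \<bottom>, so \<open>rel_bot\<close>
    makes it empty.\<close>
  then have "?D \<le> heyting_neg F"
    using W(1) rel_bot by (simp add: le_heyting_neg_iff)
  then show ?thesis
    by (simp add: pasts_iff antisym le_down_cone rel_refl)
qed

lemma heyting_neg_past:
  assumes "cones_preserve_Sup (\<unlhd>)" "P \<in> pasts (\<unlhd>)"
  shows "heyting_neg P \<in> futures (\<unlhd>)"
proof -
  let ?D = "up_cone (\<unlhd>) (heyting_neg P)"
  \<comment> \<open>Dually, \<open>heyting_neg P\<close> precedes \<open>?D\<close>, so the part of
    \<open>?D\<close> inside \<open>P\<close> is pulled back to a \<open>W\<close> below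
    \<open>heyting_neg P\<close>; being in the past of \<open>P\<close>, this \<open>W\<close> also
    lies in \<open>P\<close>.\<close>
  obtain W where W: "W \<unlhd> ?D \<sqinter> P" "W \<le> heyting_neg P"
    using parallel_down[OF rel_up_cone inf_le1] by blast
  have "W \<le> down_cone (\<unlhd>) (?D \<sqinter> P)" using W(1) by (rule le_down_cone)
  also have "\<dots> \<le> P"
    using down_cone_mono[OF assms(1) inf_le2] assms(2) by (metis pasts_iff)
  finally have "W = \<bottom>"
    using W(2) by (metis heyting_neg_inf le_inf_iff bot_unique)
  then have "?D \<le> heyting_neg P"
    using W(1) rel_bot by (simp add: le_heyting_neg_iff)
  then show ?thesis
    by (simp add: futures_iff antisym le_up_cone rel_refl)
qed

end

theorem theorem7p45:
  fixes rel :: "'a::frame \<Rightarrow> 'a \<Rightarrow> bool"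
  assumes "parallel_ordered_locale rel"
    and "cones_preserve_Sup rel"
    and "regular_cones rel"
  shows "(\<exists>f. bij_betw f (prime_elements (futures rel)) (IP rel)) \<and>
         (\<exists>g. bij_betw g (prime_elements (pasts rel)) (IF rel))"
proof -
  interpret parallel_ordered_locale rel by fact
  note frames = subframe_futures[OF assms(2)] subframe_pasts[OF assms(2)]
  have neg: "heyting_neg ` futures rel \<subseteq> pasts rel" "heyting_neg ` pasts rel \<subseteq> futures rel"
    using heyting_neg_future heyting_neg_past assms(2) by blast+
  have invol: "heyting_neg (heyting_neg U) = U" if "U \<in> futures rel \<or> U \<in> pasts rel" for U
    using assms(3) that by (auto simp: regular_cones_def futures_def pasts_def)
  have anti: "antimono (heyting_neg :: 'a \<Rightarrow> 'a)"
    by (intro antimonoI heyting_neg_antimono)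
  \<comment> \<open>The same abstract bijection is used twice, with \<open>futures rel\<close> and
    \<open>pasts rel\<close> in either order as \<open>S\<close> and \<open>T\<close>.\<close>
  have "bij_betw heyting_neg (prime_elements (futures rel)) (IP rel)"
    "bij_betw heyting_neg (prime_elements (pasts rel)) (IF rel)"
    unfolding IP_eq_sup_irreducibles IF_eq_sup_irreducibles
    by (intro bij_betw_prime_elements_sup_irreducibles frames neg invol anti; simp)+
  then show ?thesis by blast
qed

end
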